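(* Let $n\ge 1$ and let $\mathcal A\subset \operatorname{End}(\mathbb C^n)$ be a totally symmetric set of cardinality $k$. Then $k\le n+1$. If moreover $\mathcal A$ is commutative, then $k\le n$.
   Context: $\operatorname{End}(\mathbb C^n)$ is the algebra of $\mathbb C$-linear endomorphisms of $\mathbb C^n$, on which $\mathrm{GL}_n(\mathbb C)$ acts by conjugation. A set $\mathcal A=\{A_1,\dots,A_k\}\subset\operatorname{End}(\mathbb C^n)$ of $k$ distinct elements is a totally symmetric set (of cardinality $k$) if for every permutation $\sigma$ of $\{1,\dots,k\}$ there is $\rho(\sigma)\in \mathrm{GL}_n(\mathbb C)$ with $\rho(\sigma)A_i\rho(\sigma)^{-1}=A_{\sigma(i)}$ for all $i$ (the assignment $\sigma\mapsto\rho(\sigma)$ is only a map of sets, not necessarily a homomorphism). $\mathcal A$ is commutative if its elements pairwise commute. *)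

theory Defs
  imports "HOL-Analysis.Analysis" "HOL-Combinatorics.Permutations"
begin

text \<open>
  Linearity is over the complex numbers, with respect to the scaling \<open>(*s)\<close>; the
  unqualified constant \<open>linear\<close> of the analysis library would only express real linearity.
  The dimension of \<open>complex^'n\<close> is \<open>CARD('n)\<close>, which is at least 1.
\<close>

definition End_C :: "(complex^'n \<Rightarrow> complex^'n) set"
  where "End_C = {f. Vector_Spaces.linear (*s) (*s) f}"

definition GL_C :: "(complex^'n \<Rightarrow> complex^'n) set"
  where "GL_C = {g \<in> End_C. bij g}"

text \<open>
  The bijection forces \<open>\<A>\<close> to be finite with exactly \<open>k\<close> elements.  If the symmetry
  condition holds for one enumeration of \<open>\<A>\<close> by \<open>{1..k}\<close>, then it holds for all of them.
\<close>

definition totally_symmetric_set :: "nat \<Rightarrow> (complex^'n \<Rightarrow> complex^'n) set \<Rightarrow> bool"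
  where "totally_symmetric_set k \<A> \<longleftrightarrow>
    \<A> \<subseteq> End_C \<and>
    (\<exists>A. bij_betw A {1..k} \<A> \<and>
      (\<forall>\<sigma>. \<sigma> permutes {1..k} \<longrightarrow>
        (\<exists>\<rho>\<in>GL_C. \<forall>i\<in>{1..k}. \<rho> \<circ> A i \<circ> inv \<rho> = A (\<sigma> i))))"

definition commutative_set :: "(complex^'n \<Rightarrow> complex^'n) set \<Rightarrow> bool"
  where "commutative_set \<A> \<longleftrightarrow> (\<forall>A\<in>\<A>. \<forall>B\<in>\<A>. A \<circ> B = B \<circ> A)"

end

theory Submission
  imports Defs "HOL-Computational_Algebra.Fundamental_Theorem_Algebra"
begin

text \<open>
  The bound comes from cutting the symmetric set into pieces along subspaces that the
  stabilizer of one element must preserve, until only small cases remain.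

  Write \<open>A_1, ..., A_k\<close> for the set and let \<open>V = C^n\<close>.  The argument treats two kinds of
  families together: endomorphisms of \<open>V\<close> permuted up to conjugation, as in the theorem, and
  linear maps \<open>V \<rightarrow> W\<close> permuted by pairs \<open>(g, h)\<close> of automorphisms of \<open>V\<close> and \<open>W\<close>.  Distinctness is
  replaced by nonconstancy.  Because the symmetric group is 2-transitive, a symmetric family
  is either constant or injective, so nothing is lost; and a nonconstant family has to
  remain nonconstant on some piece whenever it is cut.  The bounds, for nonconstant families, are
  \<open>k \<le> dim V + dim W\<close> for maps \<open>V \<rightarrow> W\<close>, \<open>k \<le> dim V + 1\<close> for endomorphisms, and
  \<open>k \<le> dim V\<close> for commuting endomorphisms.  They are immediate for \<open>k \<le> 2\<close>, and for \<open>k \<ge> 3\<close> a family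
  stays nonconstant when one index is removed.

  Endomorphisms (\<open>card_end_family_le_step\<close>).  Let \<open>N\<close> be an eigenspace of \<open>A_k\<close>.  It is
  neither 0 nor \<open>V\<close>, since a scalar \<open>A_k\<close> would make all \<open>A_i\<close> the same scalar, and it is
  preserved by all symmetries that fix \<open>k\<close>.  These still permute \<open>A_1, ..., A_(k-1)\<close> arbitrarily.
  Subtract from these their mean, to get a family with sum 0.  If this family is not constant as a
  family of maps \<open>N \<rightarrow> V/N\<close>, the bound for maps applies to it in total dimension \<open>n\<close>.
  Otherwise it is 0 there, so it preserves \<open>N\<close>; if it is not constant on \<open>N\<close>
  or on \<open>V/N\<close>, induction applies; and otherwise it is a family of maps \<open>V/N \<rightarrow> N\<close>, again in
  total dimension \<open>n\<close>.  Hence \<open>k - 1 \<le> n\<close>.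

  Maps \<open>V \<rightarrow> W\<close> (\<open>card_hom_family_le_step\<close>).  Here \<open>A_k\<close> is not 0, as otherwise all \<open>A_i\<close> would be.
  The same kind of cut, along the kernel of \<open>A_k\<close> in \<open>V\<close> or along its image in \<open>W\<close>, loses one index
  and at least one dimension, unless \<open>A_k\<close> is an isomorphism.  In that case the \<open>A_i A_k^(-1)\<close> with
  \<open>i < k\<close> are permuted up to conjugation on \<open>W\<close>.  Endomorphisms of a line are scalars and give no
  nonconstant family, so \<open>dim W \<ge> 2\<close>, and \<open>k - 1 \<le> dim W + 1\<close> becomes \<open>k \<le> dim V + dim W\<close>.  The
  bounds for maps and for endomorphisms are proved in one induction on the total dimension.

  Commuting endomorphisms (\<open>card_commuting_end_family_le\<close>).  The eigenspace \<open>N\<close> of \<open>A_k\<close> is now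
  preserved by all \<open>A_i\<close>.  If those with \<open>i < k\<close> differ on \<open>N\<close>, induction applies to \<open>N\<close>.
  If they agree there, some \<open>w\<close> is an eigenvector for \<open>A_k\<close> with eigenvalue \<open>c\<close> and for all other
  \<open>A_i\<close> with one common eigenvalue \<open>m\<close>.  If \<open>c \<noteq> m\<close>, the images of \<open>w\<close> under the symmetries
  give \<open>k\<close> joint eigenvectors with distinct eigenvalue patterns, so they are independent.  If
  \<open>c = m\<close>, the joint eigenspace is a nonzero proper subspace invariant under the whole symmetric
  group, so cutting along it loses no index, and the pieces give \<open>k \<le> n\<close>.
\<close>

section \<open>Linear endomorphisms and eigenvectors\<close>

lemma End_C_D:
  assumes "f \<in> End_C"
  shows End_C_add: "f (x + y) = f x + f y"
    and End_C_scale: "f (c *s x) = c *s f x"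
    and End_C_0: "f 0 = 0"
    and End_C_diff: "f (x - y) = f x - f y"
    and End_C_sum: "f (\<Sum>i\<in>S. F i) = (\<Sum>i\<in>S. f (F i))"
proof -
  have l: "Vector_Spaces.linear (*s) (*s) f" using assms by (simp add: End_C_def)
  interpret f: Vector_Spaces.linear "(*s)" "(*s)" f by (rule l)
  show "f (x + y) = f x + f y" "f (c *s x) = c *s f x" "f 0 = 0" "f (x - y) = f x - f y"
    "f (\<Sum>i\<in>S. F i) = (\<Sum>i\<in>S. f (F i))"
    by (simp_all add: f.add f.scale f.diff f.sum)
qed

lemma End_CI:
  assumes "\<And>x y. f (x + y) = f x + f y" "\<And>c x. f (c *s x) = c *s f x"
  shows "f \<in> End_C"
  unfolding End_C_def mem_Collect_eq Vector_Spaces.linear_iff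
  using assms vec.vector_space_axioms by blast

lemma End_C_comp: "f \<in> End_C \<Longrightarrow> g \<in> End_C \<Longrightarrow> f \<circ> g \<in> End_C"
  by (rule End_CI) (simp_all add: End_C_D)

lemma subspace_image_End_C:
  assumes "f \<in> End_C" "vec.subspace V"
  shows "vec.subspace (f ` V)"
  using assms unfolding End_C_def
  by (metis linear_iff_module_hom mem_Collect_eq module_hom.subspace_image)

lemma dim_image_End_C:
  assumes "f \<in> End_C" "vec.subspace V" "inj_on f V"
  shows "vec.dim (f ` V) = vec.dim V"
proof -
  have "Vector_Spaces.linear (*s) (*s) f" "inj_on f (vec.span V)"
    using assms by (simp_all add: End_C_def vec.span_eq_iff[THEN iffD2])
  then show ?thesis by (rule vec.dim_image_eq)
qed

text \<open>
  Split off a linear factor \<open>x - a\<close> of \<open>p\<close> and let \<open>q\<close> be the cofactor.  Either \<open>q(f) v\<close> is already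
  an eigenvector for \<open>a\<close>, or \<open>q\<close> is an annihilating polynomial of smaller degree.
\<close>

lemma eigenvector_if_annihilated:
  fixes f :: "complex^'n \<Rightarrow> complex^'n" and p :: "complex poly"
  assumes f: "f \<in> End_C" "f ` V \<subseteq> V" and V: "vec.subspace V"
  shows "p \<noteq> 0 \<Longrightarrow> v \<in> V \<Longrightarrow> v \<noteq> 0 \<Longrightarrow> (\<Sum>i\<le>degree p. coeff p i *s (f ^^ i) v) = 0 \<Longrightarrow>
    \<exists>c. \<exists>w\<in>V. w \<noteq> 0 \<and> f w = c *s w"
proof (induction "degree p" arbitrary: p v)
  case 0
  then have "coeff p 0 \<noteq> 0"
    by (metis leading_coeff_0_iff)
  with 0 show ?case by (simp add: vec_eq_iff)
next
  case (Suc n)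
  obtain a where "poly p a = 0"
    using fundamental_theorem_of_algebra constant_degree Suc.hyps(2) by (metis nat.distinct(1))
  then obtain q where q: "p = [:-a, 1:] * q" by (auto simp: poly_eq_0_iff_dvd)
  have "q \<noteq> 0" using q Suc.prems by auto
  moreover have "[:-a, 1:] \<noteq> 0" by simp
  ultimately have "degree p = 1 + degree q" unfolding q by (subst degree_mult_eq) auto
  then have dq: "degree q = n" using Suc.hyps(2) by simp
  define w where "w = (\<Sum>i\<le>degree q. coeff q i *s (f ^^ i) v)"
  have fi: "(f ^^ i) v \<in> V" for i
    using Suc.prems f(2) by (induction i) auto
  have w: "w \<in> V" unfolding w_def
    by (intro vec.subspace_sum vec.subspace_scale V fi)
  have qn: "coeff q (Suc n) = 0" using dq by (simp add: coeff_eq_0)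
  have "0 = (\<Sum>i\<le>Suc n. coeff p i *s (f ^^ i) v)" using Suc by simp
  also have "\<dots> = (\<Sum>i\<le>Suc n. (case i of 0 \<Rightarrow> 0 | Suc j \<Rightarrow> coeff q j *s (f ^^ i) v)
      - (a * coeff q i) *s (f ^^ i) v)"
    by (rule sum.cong) (auto simp: q coeff_pCons algebra_simps vec.scale_left_diff_distrib split: nat.split)
  also have "\<dots> = (\<Sum>i\<le>Suc n. (case i of 0 \<Rightarrow> 0 | Suc j \<Rightarrow> coeff q j *s (f ^^ i) v))
      - (\<Sum>i\<le>Suc n. (a * coeff q i) *s (f ^^ i) v)"
    by (rule sum_subtractf)
  also have "(\<Sum>i\<le>Suc n. (case i of 0 \<Rightarrow> 0 | Suc j \<Rightarrow> coeff q j *s (f ^^ i) v)) = f w"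
    by (subst sum.atMost_Suc_shift) (simp add: w_def dq End_C_D[OF f(1)])
  also have "(\<Sum>i\<le>Suc n. (a * coeff q i) *s (f ^^ i) v) = a *s w"
    by (simp add: w_def dq qn vec.scale_sum_right)
  finally have "f w = a *s w" by simp
  then show ?case
  proof (cases "w = 0")
    case True
    then show ?thesis
      using Suc.hyps(1)[OF dq[symmetric] \<open>q \<noteq> 0\<close> Suc.prems(2,3)] w_def by simp
  qed (use w in blast)
qed

text \<open>
  The \<open>n + 1\<close> vectors \<open>v, f v, ..., f^n v\<close> in \<open>n\<close>-dimensional space satisfy a linear relation,
  which is a polynomial that annihilates \<open>v\<close>.
\<close>

lemma eigenvector_exists:
  fixes f :: "complex^'n \<Rightarrow> complex^'n"
  assumes f: "f \<in> End_C" "f ` V \<subseteq> V" and V: "vec.subspace V" and v: "v \<in> V" "v \<noteq> 0"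
  obtains c w where "w \<in> V" "w \<noteq> 0" "f w = c *s w"
proof -
  let ?N = "CARD('n)"
  let ?e = "\<lambda>i. (f ^^ i) v"
  have "\<exists>c. (\<exists>i\<le>?N. c i \<noteq> 0) \<and> (\<Sum>i\<le>?N. c i *s ?e i) = 0"
  proof (cases "inj_on ?e {..?N}")
    case True
    have "vec.dependent (?e ` {..?N})"
    proof (rule vec.dependent_biggerset_general)
      have "vec.dim (?e ` {..?N}) \<le> ?N"
        using vec.dim_subset_UNIV[of "?e ` {..?N}"] by (simp add: vec.dimension_def card_cart_basis)
      then show "vec.dim (?e ` {..?N}) < card (?e ` {..?N})"
        by (simp add: card_image[OF True])
    qed
    then obtain u where u: "\<exists>x\<in>?e ` {..?N}. u x \<noteq> 0" "(\<Sum>x\<in>?e ` {..?N}. u x *s x) = 0"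
      using vec.dependent_finite[of "?e ` {..?N}"] by auto
    then show ?thesis
      by (intro exI[of _ "\<lambda>i. u (?e i)"]) (auto simp: sum.reindex[OF True])
  next
    case False
    then obtain i j where ij: "i \<le> ?N" "j \<le> ?N" "i \<noteq> j" "?e i = ?e j"
      by (auto simp: inj_on_def)
    \<comment> \<open>two equal powers give the relation \<open>f^i v - f^j v = 0\<close>\<close>
    let ?c = "\<lambda>l. (if l = i then 1 else 0) - (if l = j then 1 else 0) :: complex"
    have "(\<Sum>l\<le>?N. ?c l *s ?e l)
        = (\<Sum>l\<le>?N. if l = i then ?e l else 0) - (\<Sum>l\<le>?N. if l = j then ?e l else 0)"
      unfolding sum_subtractf[symmetric] by (rule sum.cong) auto
    also have "\<dots> = 0" using ij by simp
    finally have "(\<Sum>l\<le>?N. ?c l *s ?e l) = 0" .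
    moreover have "?c i \<noteq> 0" using ij by simp
    ultimately show ?thesis using ij(1) by (intro exI[of _ ?c] conjI) auto
  qed
  then obtain c where c: "\<exists>i\<le>?N. c i \<noteq> 0" "(\<Sum>i\<le>?N. c i *s ?e i) = 0" by blast
  define p where "p = (\<Sum>i\<le>?N. monom (c i) i)"
  have cp: "coeff p i = (if i \<le> ?N then c i else 0)" for i
    by (simp add: p_def coeff_sum)
  have "p \<noteq> 0" using c(1) cp by (metis coeff_0)
  moreover have "(\<Sum>i\<le>degree p. coeff p i *s ?e i) = (\<Sum>i\<le>?N. coeff p i *s ?e i)"
  proof (rule sum.mono_neutral_left)
    show "{..degree p} \<subseteq> {..?N}" using cp by (auto intro: degree_le order_trans)
  qed (auto simp: coeff_eq_0)
  ultimately show thesis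
    using eigenvector_if_annihilated[OF f V _ v, of p] c(2) that by (simp add: cp) blast
qed

section \<open>Automorphisms of subspaces and quotients\<close>

text \<open>
  Maps between subspaces are represented by linear maps on the whole space, considered only on the
  subspace.  In finite dimension an injective \<open>g\<close> that maps \<open>V\<close> into itself maps it onto itself.
\<close>

definition aut_on :: "(complex^'n) set \<Rightarrow> (complex^'n \<Rightarrow> complex^'n) set"
  where "aut_on V = {g \<in> End_C. g ` V \<subseteq> V \<and> inj_on g V}"

lemma aut_onD:
  assumes "g \<in> aut_on V"
  shows "g \<in> End_C" "v \<in> V \<Longrightarrow> g v \<in> V" "x \<in> V \<Longrightarrow> y \<in> V \<Longrightarrow> g x = g y \<Longrightarrow> x = y"
  using assms by (auto simp: aut_on_def inj_on_def)

lemma aut_on_image_eq: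
  assumes "g \<in> aut_on V" "vec.subspace V"
  shows "g ` V = V"
  using assms
  by (intro vec.subspace_dim_equal)
    (simp_all add: aut_on_def subspace_image_End_C dim_image_End_C)

lemma aut_on_subspace:
  assumes "g \<in> aut_on V" "N \<subseteq> V" "\<And>v. v \<in> N \<Longrightarrow> g v \<in> N"
  shows "g \<in> aut_on N"
  using assms inj_on_subset[of g V N] by (auto simp: aut_on_def)

text \<open>
  The quotient of a subspace \<open>V\<close> by \<open>N\<close> is modelled by \<open>p ` V\<close>, for a linear projection \<open>p\<close>
  with kernel \<open>N\<close>; the image of \<open>p\<close> is a complement of \<open>N\<close>, and \<open>p ` V\<close> its part inside \<open>V\<close>.
\<close>

definition projection_mod :: "(complex^'n) set \<Rightarrow> (complex^'n \<Rightarrow> complex^'n) \<Rightarrow> bool"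
  where "projection_mod N p \<longleftrightarrow> p \<in> End_C \<and> (\<forall>v. p v = 0 \<longleftrightarrow> v \<in> N) \<and> (\<forall>v. p (p v) = p v)"

lemma projection_modD:
  assumes "projection_mod N p"
  shows "p \<in> End_C" "p v = 0 \<longleftrightarrow> v \<in> N" "p (p v) = p v" "v - p v \<in> N"
proof -
  show p: "p \<in> End_C" and 1: "\<And>v. p v = 0 \<longleftrightarrow> v \<in> N" and 2: "p (p v) = p v"
    using assms by (auto simp: projection_mod_def)
  show "v - p v \<in> N" using 2 by (simp add: 1[symmetric] End_C_diff[OF p])
qed

lemma projection_mod_exists:
  assumes "vec.subspace N"
  obtains p where "projection_mod N p"
proof -
  obtain B where B: "B \<subseteq> N" "vec.independent B" "vec.span B = N"
    using vec.basis_subspace_exists[OF assms] by metis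
  obtain C where C: "B \<subseteq> C" "vec.independent C" "UNIV \<subseteq> vec.span C"
    using vec.maximal_independent_subset_extend[of B UNIV] B by auto
  obtain p where p: "Vector_Spaces.linear (*s) (*s) p" and pC: "\<forall>x\<in>C. p x = (if x \<in> B then 0 else x)"
    using vec.linear_independent_extend[OF C(2), of "\<lambda>x. if x \<in> B then 0 else x"] by blast
  have pE: "p \<in> End_C" using p by (simp add: End_C_def)
  note pl = End_C_D[OF pE]
  have 1: "p v = 0" if "v \<in> N" for v
  proof -
    have "v \<in> vec.span B" using that B by simp
    then show ?thesis
      by (induction rule: vec.span_induct_alt) (use pC C(1) in \<open>auto simp: pl subset_iff\<close>)
  qed
  have 2: "v - p v \<in> N" for v
  proof -
    have "v \<in> vec.span C" using C by auto
    then show ?thesis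
    proof (induction rule: vec.span_induct_alt)
      case base show ?case using vec.subspace_0[OF assms] by (simp add: pl)
    next
      case (step c x y)
      have "x - p x \<in> N" using pC step(1) B(1) vec.subspace_0[OF assms] by auto
      then have "c *s (x - p x) + (y - p y) \<in> N"
        using step(2) assms by (intro vec.subspace_add vec.subspace_scale)
      then show ?case by (simp add: pl vec.scale_right_diff_distrib algebra_simps)
    qed
  qed
  have "projection_mod N p" unfolding projection_mod_def
  proof (intro conjI allI iffI)
    fix v
    show "p (p v) = p v" using 1[OF 2[of v]] by (simp add: pl)
    show "v \<in> N" if "p v = 0" using 2[of v] that by simp
  qed (use pE 1 in auto)
  then show thesis by (rule that)
qed

context
  fixes V N :: "(complex^'n) set" and p
  assumes V: "vec.subspace V" and N: "vec.subspace N" "N \<subseteq> V" and p: "projection_mod N p"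
begin

lemma projection_image_subset: "p ` V \<subseteq> V"
proof clarify
  fix v assume "v \<in> V"
  then have "v - (v - p v) \<in> V"
    using vec.subspace_diff[OF V] N(2) projection_modD(4)[OF p] by blast
  then show "p v \<in> V" by simp
qed

lemma subspace_projection_image: "vec.subspace (p ` V)"
  using subspace_image_End_C[OF projection_modD(1)[OF p] V] .

lemma dim_projection_image: "vec.dim N + vec.dim (p ` V) \<le> vec.dim V"
proof -
  have "x = 0" if "x \<in> N" "x \<in> p ` V" for x
  proof -
    have "p x = x" using that(2) projection_modD(3)[OF p] by auto
    then show ?thesis using that(1) projection_modD(2)[OF p, of x] by simp
  qed
  then have "N \<inter> p ` V \<subseteq> {0}" by blast
  then have "vec.dim (N \<inter> p ` V) = 0" by simp
  moreover have "vec.dim {x + y |x y. x \<in> N \<and> y \<in> p ` V} \<le> vec.dim V"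
    using N(2) projection_image_subset by (intro vec.dim_subset) (auto intro!: vec.subspace_add[OF V])
  ultimately show ?thesis
    using vec.dim_sums_Int[OF N(1) subspace_projection_image] by linarith
qed

text \<open>
  The map \<open>p \<circ> g\<close> is the one that \<open>g\<close> induces on the quotient.  It is injective because \<open>g\<close> maps \<open>N\<close>
  onto itself, so that \<open>g\<close> cannot move a vector from outside \<open>N\<close> into \<open>N\<close>.
\<close>

lemma projection_comp_aut_on:
  assumes g: "g \<in> aut_on V" and gN: "\<And>v. v \<in> N \<Longrightarrow> g v \<in> N"
  shows "p \<circ> g \<in> aut_on (p ` V)"
proof -
  note gE = End_C_D[OF aut_onD(1)[OF g]] and pE = End_C_D[OF projection_modD(1)[OF p]]
  have gN': "g ` N = N"
    using aut_on_image_eq[OF aut_on_subspace[OF g N(2) gN] N(1)] .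
  have "inj_on (p \<circ> g) (p ` V)"
  proof (rule inj_onI)
    fix x y assume xy: "x \<in> p ` V" "y \<in> p ` V" "(p \<circ> g) x = (p \<circ> g) y"
    have "p (g (x - y)) = 0" using xy by (simp add: gE pE)
    then have "g (x - y) \<in> g ` N" using projection_modD(2)[OF p] gN' by simp
    then obtain z where z: "z \<in> N" "g (x - y) = g z" by auto
    have "x - y \<in> V" using xy projection_image_subset vec.subspace_diff[OF V] by blast
    then have "x - y \<in> N" using aut_onD(3)[OF g _ _ z(2)] z(1) N(2) by auto
    then have "p x - p y = 0" using projection_modD(2)[OF p] by (metis pE(4))
    moreover have "p x = x" "p y = y" using xy projection_modD(3)[OF p] by auto
    ultimately show "x = y" by simp
  qed
  then show ?thesis
    using projection_image_subset aut_onD(2)[OF g]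
    by (auto simp: aut_on_def intro!: End_C_comp projection_modD(1)[OF p] aut_onD(1)[OF g])
qed

text \<open>
  An endomorphism preserving \<open>N\<close> is well defined modulo \<open>N\<close>.  This makes \<open>f \<mapsto> p \<circ> f\<close> compatible
  with composition on \<open>p ` V\<close>.
\<close>

lemma projection_absorb:
  assumes "f \<in> End_C" and "\<And>v. v \<in> N \<Longrightarrow> f v \<in> N"
  shows "p (f (p v)) = p (f v)"
proof -
  have "p (f (v - p v)) = 0"
    using assms(2) projection_modD(2,4)[OF p] by blast
  then show ?thesis by (simp add: End_C_D[OF assms(1)] End_C_D[OF projection_modD(1)[OF p]])
qed

end

section \<open>Centred families\<close>

text \<open>
  Subtracting the mean keeps all differences and all symmetries of a family.  It turns
  ``constant'' into ``zero'', which is what lets a family that is constant as maps into a quotient be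
  restricted to a subspace.
\<close>

definition centred :: "'i set \<Rightarrow> ('i \<Rightarrow> complex^'n \<Rightarrow> complex^'n) \<Rightarrow> 'i \<Rightarrow> complex^'n \<Rightarrow> complex^'n"
  where "centred J A i v = A i v - (1 / of_nat (card J)) *s (\<Sum>j\<in>J. A j v)"

lemma centred_eq_iff: "centred J A i v = centred J A j v \<longleftrightarrow> A i v = A j v"
  by (simp add: centred_def)

lemma centred_End_C:
  assumes "\<And>j. j \<in> J \<Longrightarrow> A j \<in> End_C" "i \<in> J"
  shows "centred J A i \<in> End_C"
proof (rule End_CI)
  have "(\<Sum>j\<in>J. A j (x + y)) = (\<Sum>j\<in>J. A j x) + (\<Sum>j\<in>J. A j y)" for x y
    unfolding sum.distrib[symmetric] by (rule sum.cong) (simp_all add: End_C_add assms(1))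
  then show "centred J A i (x + y) = centred J A i x + centred J A i y" for x y
    by (simp add: centred_def End_C_add[OF assms(1)[OF assms(2)]] vec.scale_right_distrib)
  have "(\<Sum>j\<in>J. A j (c *s x)) = c *s (\<Sum>j\<in>J. A j x)" for c x
    unfolding vec.scale_sum_right by (rule sum.cong) (simp_all add: End_C_scale assms(1))
  then show "centred J A i (c *s x) = c *s centred J A i x" for c x
    by (simp add: centred_def End_C_scale[OF assms(1)[OF assms(2)]] vec.scale_right_diff_distrib mult.commute)
qed

lemma centred_mem:
  assumes "vec.subspace W" "\<And>j. j \<in> J \<Longrightarrow> A j v \<in> W" "i \<in> J"
  shows "centred J A i v \<in> W"
  unfolding centred_def using assms
  by (intro vec.subspace_diff vec.subspace_scale vec.subspace_sum) auto

lemma centred_equivariant: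
  assumes h: "h \<in> End_C" and \<sigma>: "\<sigma> permutes J" and i: "i \<in> J"
    and eq: "\<And>j. j \<in> J \<Longrightarrow> h (A j v) = A (\<sigma> j) (g v)"
  shows "h (centred J A i v) = centred J A (\<sigma> i) (g v)"
proof -
  have "(\<Sum>j\<in>J. h (A j v)) = (\<Sum>j\<in>J. A (\<sigma> j) (g v))" using eq by simp
  also have "\<dots> = (\<Sum>j\<in>J. A j (g v))" using sum.permute[OF \<sigma>, of "\<lambda>j. A j (g v)"] by (simp add: o_def)
  finally show ?thesis using eq[OF i] by (simp add: centred_def End_C_D[OF h])
qed

lemma centred_eq_0:
  assumes f: "f \<in> End_C" and J: "finite J" "i \<in> J"
    and eq: "\<And>j. j \<in> J \<Longrightarrow> f (A j v) = f (A i v)"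
  shows "f (centred J A i v) = 0"
proof -
  have "(\<Sum>j\<in>J. f (A j v)) = of_nat (card J) *s f (A i v)"
    using eq by (simp add: vec_eq_iff)
  moreover have "card J \<noteq> 0" using J by auto
  ultimately show ?thesis by (simp add: centred_def End_C_D[OF f])
qed

lemma centred_eq_0_if_const:
  assumes "finite J" "i \<in> J" "\<And>j. j \<in> J \<Longrightarrow> A j v = A i v"
  shows "centred J A i v = 0"
proof -
  have "(\<lambda>v. v) \<in> End_C" by (rule End_CI) simp_all
  from centred_eq_0[OF this assms(1,2), of A v] assms(3) show ?thesis by blast
qed

text \<open>
  Commuting with \<open>A a\<close> is equivariance for the identity permutation, so the equivariance of
  centring, applied in each of the two variables, gives the claim.
\<close>

lemma centred_commute:
  assumes E: "\<And>j. j \<in> J \<Longrightarrow> A j \<in> End_C" and ij: "i \<in> J" "j \<in> J"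
    and c: "\<And>a b. a \<in> J \<Longrightarrow> b \<in> J \<Longrightarrow> A a (A b v) = A b (A a v)"
  shows "centred J A i (centred J A j v) = centred J A j (centred J A i v)"
proof -
  have 1: "A a (centred J A j v) = centred J A j (A a v)" if "a \<in> J" for a
    using centred_equivariant[where A = A and v = v and g = "A a", OF E[OF that] permutes_id ij(2)]
      c[OF that] by simp
  show ?thesis
    using centred_equivariant[where A = A and v = v and g = "centred J A j",
        OF centred_End_C[OF E ij(2)] permutes_id ij(1)] 1 by simp
qed

section \<open>Nonconstant symmetric families\<close>

definition nonconstant_on :: "'a set \<Rightarrow> 'i set \<Rightarrow> ('i \<Rightarrow> 'a \<Rightarrow> 'b) \<Rightarrow> bool"
  where "nonconstant_on V I A \<longleftrightarrow> (\<exists>i\<in>I. \<exists>j\<in>I. \<exists>v\<in>V. A i v \<noteq> A j v)"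

text \<open>
  Families of maps \<open>V \<rightarrow> W\<close> whose indices can be permuted arbitrarily by automorphisms of source and
  target.  The equation \<open>h (A i v) = A (\<sigma> i) (g v)\<close> is that of conjugation, cleared of inverses.
  Nonconstancy replaces distinctness, to which it is equivalent by \<open>hom_family_differ\<close>, because it
  can be tested separately on each subspace and quotient.
\<close>

definition hom_family :: "'i set \<Rightarrow> (complex^'n) set \<Rightarrow> (complex^'n) set \<Rightarrow>
    ('i \<Rightarrow> complex^'n \<Rightarrow> complex^'n) \<Rightarrow> bool"
  where "hom_family I V W A \<longleftrightarrow>
    finite I \<and> vec.subspace V \<and> vec.subspace W \<and>
    (\<forall>i\<in>I. A i \<in> End_C \<and> A i ` V \<subseteq> W) \<and>
    (\<forall>\<sigma>. \<sigma> permutes I \<longrightarrow>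
      (\<exists>g\<in>aut_on V. \<exists>h\<in>aut_on W. \<forall>i\<in>I. \<forall>v\<in>V. h (A i v) = A (\<sigma> i) (g v))) \<and>
    nonconstant_on V I A"

definition end_family :: "'i set \<Rightarrow> (complex^'n) set \<Rightarrow>
    ('i \<Rightarrow> complex^'n \<Rightarrow> complex^'n) \<Rightarrow> bool"
  where "end_family I V A \<longleftrightarrow>
    finite I \<and> vec.subspace V \<and>
    (\<forall>i\<in>I. A i \<in> End_C \<and> A i ` V \<subseteq> V) \<and>
    (\<forall>\<sigma>. \<sigma> permutes I \<longrightarrow>
      (\<exists>g\<in>aut_on V. \<forall>i\<in>I. \<forall>v\<in>V. g (A i v) = A (\<sigma> i) (g v))) \<and>
    nonconstant_on V I A"

lemma hom_familyD:
  assumes "hom_family I V W A"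
  shows "finite I" "vec.subspace V" "vec.subspace W" "i \<in> I \<Longrightarrow> A i \<in> End_C"
    "i \<in> I \<Longrightarrow> v \<in> V \<Longrightarrow> A i v \<in> W" "nonconstant_on V I A"
  using assms by (auto simp: hom_family_def)

lemma hom_family_symmetry:
  assumes "hom_family I V W A" "\<sigma> permutes I"
  obtains g h where "g \<in> aut_on V" "h \<in> aut_on W"
    "\<And>i v. i \<in> I \<Longrightarrow> v \<in> V \<Longrightarrow> h (A i v) = A (\<sigma> i) (g v)"
  using assms by (fastforce simp: hom_family_def)

lemma end_familyD:
  assumes "end_family I V A"
  shows "finite I" "vec.subspace V" "i \<in> I \<Longrightarrow> A i \<in> End_C"
    "i \<in> I \<Longrightarrow> v \<in> V \<Longrightarrow> A i v \<in> V" "nonconstant_on V I A"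
  using assms by (auto simp: end_family_def)

lemma end_family_symmetry:
  assumes "end_family I V A" "\<sigma> permutes I"
  obtains g where "g \<in> aut_on V"
    "\<And>i v. i \<in> I \<Longrightarrow> v \<in> V \<Longrightarrow> g (A i v) = A (\<sigma> i) (g v)"
  using assms by (fastforce simp: end_family_def)

lemma end_family_imp_hom_family: "end_family I V A \<Longrightarrow> hom_family I V V A"
  unfolding end_family_def hom_family_def by blast

text \<open>The symmetric group is 2-transitive.\<close>

lemma permutation_moving_pair:
  assumes "i \<in> I" "j \<in> I" "i \<noteq> j" "i' \<in> I" "j' \<in> I" "i' \<noteq> j'"
  obtains \<sigma> where "\<sigma> permutes I" "\<sigma> i = i'" "\<sigma> j = j'"
proof
  let ?\<tau> = "Transposition.transpose i i'"
  let ?\<sigma> = "Transposition.transpose (?\<tau> j) j' \<circ> ?\<tau>"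
  have "?\<tau> j \<in> I" using assms by (auto simp: Transposition.transpose_def)
  then show "?\<sigma> permutes I"
    using assms by (intro permutes_compose permutes_swap_id)
  have "?\<tau> j \<noteq> i'" using assms by (auto simp: Transposition.transpose_def)
  then show "?\<sigma> i = i'" using assms by (simp add: Transposition.transpose_def)
  show "?\<sigma> j = j'" by simp
qed

text \<open>
  By 2-transitivity, two members that agree on \<open>V\<close> could be moved to any other two, and all
  would agree.
\<close>

lemma hom_family_differ:
  assumes A: "hom_family I V W A" and ij: "i \<in> I" "j \<in> I" "i \<noteq> j"
  shows "\<exists>v\<in>V. A i v \<noteq> A j v"
proof (rule ccontr)
  assume eq: "\<not> ?thesis"
  obtain i' j' v where v: "i' \<in> I" "j' \<in> I" "v \<in> V" "A i' v \<noteq> A j' v"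
    using hom_familyD(6)[OF A] by (auto simp: nonconstant_on_def)
  then have "i' \<noteq> j'" by auto
  then obtain \<sigma> where \<sigma>: "\<sigma> permutes I" "\<sigma> i = i'" "\<sigma> j = j'"
    using permutation_moving_pair ij v by metis
  obtain g h where gh: "g \<in> aut_on V" "h \<in> aut_on W"
    "\<And>i v. i \<in> I \<Longrightarrow> v \<in> V \<Longrightarrow> h (A i v) = A (\<sigma> i) (g v)"
    using hom_family_symmetry[OF A \<sigma>(1)] by metis
  obtain u where u: "u \<in> V" "v = g u"
    using v(3) aut_on_image_eq[OF gh(1) hom_familyD(2)[OF A]] by blast
  show False
    using eq gh(3)[OF ij(1) u(1)] gh(3)[OF ij(2) u(1)] v(4) u \<sigma> by auto
qed

text \<open>
  What is left after the removal of one index has at least two members, and these differ.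
\<close>

lemma nonconstant_on_remove:
  assumes A: "hom_family I V W A" and "3 \<le> card I"
  shows "nonconstant_on V (I - {k}) A"
proof -
  have "2 \<le> card (I - {k})"
    using diff_card_le_card_Diff[of "{k}" I] assms(2) by simp
  then obtain S where "S \<subseteq> I - {k}" "card S = 2"
    using obtain_subset_with_card_n by metis
  then obtain i j where "i \<in> I - {k}" "j \<in> I - {k}" "i \<noteq> j"
    by (auto simp: card_2_iff)
  then show ?thesis
    using hom_family_differ[OF A, of i j] unfolding nonconstant_on_def by blast
qed

text \<open>
  The permutations of the smaller index set are the stabilizer of \<open>k\<close>.  A symmetry \<open>(g, h)\<close> that
  realizes one satisfies \<open>h (A k v) = A k (g v)\<close>, so it preserves the kernel and the image of \<open>A k\<close>,
  and also its eigenspaces if \<open>g = h\<close>.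
\<close>

lemma permutes_remove:
  assumes "\<sigma> permutes I - {k}"
  shows "\<sigma> permutes I" "\<sigma> k = k"
  using assms by (auto intro: permutes_subset simp: permutes_not_in)

section \<open>Cutting along an invariant subspace\<close>

text \<open>
  Written in blocks along \<open>N\<close> and \<open>V/N\<close>, the centred family \<open>B\<close> has four parts: \<open>N \<rightarrow> V/N\<close>, \<open>N \<rightarrow> N\<close>,
  \<open>V/N \<rightarrow> V/N\<close> and \<open>V/N \<rightarrow> N\<close>.  In this order, each part is equivariant once the ones before it
  vanish, and a part that is constant does vanish because \<open>B\<close> is centred.  The first part that is not
  constant yields the family; the last one cannot be constant if the others are.
\<close>

lemma end_family_devissage:
  fixes A :: "'i \<Rightarrow> complex^'n \<Rightarrow> complex^'n"
  assumes J: "finite J" and V: "vec.subspace V" and N: "vec.subspace N" "N \<subseteq> V"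
    and p: "projection_mod N p"
    and A: "\<And>i. i \<in> J \<Longrightarrow> A i \<in> End_C" "\<And>i v. i \<in> J \<Longrightarrow> v \<in> V \<Longrightarrow> A i v \<in> V"
    and sym: "\<And>\<sigma>. \<sigma> permutes J \<Longrightarrow> \<exists>g\<in>aut_on V. (\<forall>v\<in>N. g v \<in> N) \<and>
        (\<forall>i\<in>J. \<forall>v\<in>V. g (A i v) = A (\<sigma> i) (g v))"
    and nc: "nonconstant_on V J A"
  defines "B \<equiv> centred J A"
  shows "hom_family J N (p ` V) (\<lambda>i. p \<circ> B i) \<or>
    end_family J N B \<or>
    end_family J (p ` V) (\<lambda>i. p \<circ> B i) \<or>
    hom_family J (p ` V) N B"
proof -
  note pE = projection_modD(1)[OF p] and p0 = projection_modD(2)[OF p]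
    and pp = projection_modD(3)[OF p]
  note W = subspace_projection_image[OF V N p] and WV = projection_image_subset[OF V N p]
  note absorb = projection_absorb[OF V N p]
  have BE: "B i \<in> End_C" if "i \<in> J" for i
    using that A(1) by (simp add: B_def centred_End_C)
  have pBE: "p \<circ> B i \<in> End_C" if "i \<in> J" for i
    using BE[OF that] pE by (simp add: End_C_comp)
  have BV: "B i v \<in> V" if "i \<in> J" "v \<in> V" for i v
    using that A(2) by (simp add: B_def centred_mem V)
  have symB: "\<exists>g\<in>aut_on V. g \<in> aut_on N \<and> p \<circ> g \<in> aut_on (p ` V) \<and> (\<forall>v\<in>N. g v \<in> N) \<and>
      (\<forall>i\<in>J. \<forall>v\<in>V. g (B i v) = B (\<sigma> i) (g v))" if \<sigma>: "\<sigma> permutes J" for \<sigma>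
  proof -
    obtain g where g: "g \<in> aut_on V" "\<And>v. v \<in> N \<Longrightarrow> g v \<in> N"
      "\<And>i v. i \<in> J \<Longrightarrow> v \<in> V \<Longrightarrow> g (A i v) = A (\<sigma> i) (g v)"
      using sym[OF \<sigma>] by blast
    have "g (B i v) = B (\<sigma> i) (g v)" if "i \<in> J" "v \<in> V" for i v
      unfolding B_def using centred_equivariant[OF aut_onD(1)[OF g(1)] \<sigma> that(1), of A v g] g(3) that(2) by blast
    then show ?thesis
      using g aut_on_subspace[OF g(1) N(2) g(2)] projection_comp_aut_on[OF V N p g(1,2)] by blast
  qed
  have ncB: "nonconstant_on V J B"
    using nc by (simp add: nonconstant_on_def B_def centred_eq_iff)
  show ?thesis
  proof (cases "nonconstant_on N J (\<lambda>i. p \<circ> B i)")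
    case True
    have "\<exists>g\<in>aut_on N. \<exists>h\<in>aut_on (p ` V). \<forall>i\<in>J. \<forall>v\<in>N. h ((p \<circ> B i) v) = (p \<circ> B (\<sigma> i)) (g v)"
      if \<sigma>: "\<sigma> permutes J" for \<sigma>
    proof -
      obtain g where g: "g \<in> aut_on V" "g \<in> aut_on N" "p \<circ> g \<in> aut_on (p ` V)" "\<And>v. v \<in> N \<Longrightarrow> g v \<in> N"
        "\<And>i v. i \<in> J \<Longrightarrow> v \<in> V \<Longrightarrow> g (B i v) = B (\<sigma> i) (g v)"
        using symB[OF \<sigma>] by blast
      have "p (g (p (B i v))) = p (B (\<sigma> i) (g v))" if "i \<in> J" "v \<in> N" for i v
        using absorb[OF aut_onD(1)[OF g(1)] g(4), of "B i v"] g(5)[of i v] that N(2) by auto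
      then show ?thesis using g(2,3) by (intro bexI[of _ g] bexI[of _ "p \<circ> g"]) auto
    qed
    then have "hom_family J N (p ` V) (\<lambda>i. p \<circ> B i)"
      using True J N W pBE BV N(2) unfolding hom_family_def by (auto simp: subset_iff)
    then show ?thesis by simp
  next
    case False
    have BN: "B i v \<in> N" if "i \<in> J" "v \<in> N" for i v
    proof -
      have "p (A j v) = p (A i v)" if "j \<in> J" for j
      proof -
        have "p (B j v) = p (B i v)"
          using False that \<open>i \<in> J\<close> \<open>v \<in> N\<close> unfolding nonconstant_on_def comp_def by blast
        then show ?thesis by (simp add: B_def centred_def End_C_D[OF pE])
      qed
      then have "p (B i v) = 0" unfolding B_def using centred_eq_0[OF pE J that(1)] by blast
      then show ?thesis by (simp add: p0)
    qed
    show ?thesis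
    proof (cases "nonconstant_on N J B")
      case True
      have "\<exists>g\<in>aut_on N. \<forall>i\<in>J. \<forall>v\<in>N. g (B i v) = B (\<sigma> i) (g v)" if "\<sigma> permutes J" for \<sigma>
        using symB[OF that] N(2) by blast
      then have "end_family J N B"
        using True J N BE BN unfolding end_family_def by blast
      then show ?thesis by simp
    next
      case constN: False
      have B0: "B i v = 0" if "i \<in> J" "v \<in> N" for i v
      proof -
        have "A j v = A i v" if "j \<in> J" for j
          using constN that \<open>i \<in> J\<close> \<open>v \<in> N\<close>
          unfolding nonconstant_on_def B_def centred_eq_iff by blast
        then show ?thesis unfolding B_def using centred_eq_0_if_const[of J i A v] J that(1) by blast
      qed
      have Bp: "B i (p v) = B i v" if "i \<in> J" for i v
        using B0[OF that projection_modD(4)[OF p], of v] by (simp add: End_C_diff[OF BE[OF that]])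
      show ?thesis
      proof (cases "nonconstant_on (p ` V) J (\<lambda>i. p \<circ> B i)")
        case True
        have "\<exists>g\<in>aut_on (p ` V). \<forall>i\<in>J. \<forall>v\<in>p ` V. g ((p \<circ> B i) v) = (p \<circ> B (\<sigma> i)) (g v)"
          if \<sigma>: "\<sigma> permutes J" for \<sigma>
        proof -
          obtain g where g: "g \<in> aut_on V" "p \<circ> g \<in> aut_on (p ` V)" "\<And>v. v \<in> N \<Longrightarrow> g v \<in> N"
            "\<And>i v. i \<in> J \<Longrightarrow> v \<in> V \<Longrightarrow> g (B i v) = B (\<sigma> i) (g v)"
            using symB[OF \<sigma>] by blast
          have "p (g (p (B i v))) = p (B (\<sigma> i) (p (g v)))" if "i \<in> J" "v \<in> p ` V" for i v
            using absorb[OF aut_onD(1)[OF g(1)] g(3), of "B i v"] g(4)[of i v] that WV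
              Bp[of "\<sigma> i"] permutes_in_image[OF \<sigma>] by auto
          then show ?thesis using g(2) by (intro bexI[of _ "p \<circ> g"]) auto
        qed
        then have "end_family J (p ` V) (\<lambda>i. p \<circ> B i)"
          using True J W pBE BV WV unfolding end_family_def by (auto simp: subset_iff)
        then show ?thesis by simp
      next
        case constW: False
        have BVN: "B i v \<in> N" if "i \<in> J" "v \<in> V" for i v
        proof -
          have "p (A j v) = p (A i v)" if "j \<in> J" for j
          proof -
            have "p (B j (p v)) = p (B i (p v))"
              using constW that \<open>i \<in> J\<close> \<open>v \<in> V\<close> unfolding nonconstant_on_def comp_def by blast
            then have "p (B j v) = p (B i v)" using Bp that \<open>i \<in> J\<close> by simp
            then show ?thesis by (simp add: B_def centred_def End_C_D[OF pE])
          qed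
          then have "p (B i v) = 0" unfolding B_def using centred_eq_0[OF pE J that(1)] by blast
          then show ?thesis by (simp add: p0)
        qed
        have "\<exists>g\<in>aut_on (p ` V). \<exists>h\<in>aut_on N. \<forall>i\<in>J. \<forall>v\<in>p ` V. h (B i v) = B (\<sigma> i) (g v)"
          if \<sigma>: "\<sigma> permutes J" for \<sigma>
        proof -
          obtain g where g: "g \<in> aut_on N" "p \<circ> g \<in> aut_on (p ` V)"
            "\<And>i v. i \<in> J \<Longrightarrow> v \<in> V \<Longrightarrow> g (B i v) = B (\<sigma> i) (g v)"
            using symB[OF \<sigma>] by blast
          have "g (B i v) = B (\<sigma> i) (p (g v))" if "i \<in> J" "v \<in> p ` V" for i v
            using g(3)[of i v] that WV Bp[of "\<sigma> i"] permutes_in_image[OF \<sigma>] by auto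
          then show ?thesis using g(1,2) by (intro bexI[of _ "p \<circ> g"] bexI[of _ g]) auto
        qed
        moreover have "nonconstant_on (p ` V) J B"
          using ncB Bp unfolding nonconstant_on_def by fastforce
        ultimately have "hom_family J (p ` V) N B"
          using J N W BE BVN WV unfolding hom_family_def by blast
        then show ?thesis by simp
      qed
    qed
  qed
qed

section \<open>Kernels and eigenspaces of a member\<close>

text \<open>All members are equivalent to each other, so if one vanishes, they all do.\<close>

lemma hom_family_not_zero:
  assumes A: "hom_family I V W A" and k: "k \<in> I"
  shows "\<exists>v\<in>V. A k v \<noteq> 0"
proof (rule ccontr)
  assume eq: "\<not> ?thesis"
  have "A i v = 0" if i: "i \<in> I" and v: "v \<in> V" for i v
  proof -
    have "Transposition.transpose k i permutes I" using i k by (intro permutes_swap_id)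
    then obtain g h where g: "g \<in> aut_on V" "h \<in> aut_on W"
      "\<And>j v. j \<in> I \<Longrightarrow> v \<in> V \<Longrightarrow> h (A j v) = A (Transposition.transpose k i j) (g v)"
      using hom_family_symmetry[OF A] by metis
    obtain u where u: "u \<in> V" "v = g u"
      using v aut_on_image_eq[OF g(1) hom_familyD(2)[OF A]] by blast
    then show ?thesis using g(3)[OF k u(1)] eq by (simp add: End_C_0[OF aut_onD(1)[OF g(2)]])
  qed
  then show False using hom_familyD(6)[OF A] unfolding nonconstant_on_def by metis
qed

text \<open>
  Scalars are fixed under conjugation, so if one member is a scalar, all are the same scalar.
\<close>

lemma end_family_not_scalar:
  assumes A: "end_family I V A" and k: "k \<in> I"
  shows "\<exists>v\<in>V. A k v \<noteq> c *s v"
proof (rule ccontr)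
  assume eq: "\<not> ?thesis"
  have "A i v = c *s v" if i: "i \<in> I" and v: "v \<in> V" for i v
  proof -
    have "Transposition.transpose k i permutes I" using i k by (intro permutes_swap_id)
    then obtain g where g: "g \<in> aut_on V"
      "\<And>j v. j \<in> I \<Longrightarrow> v \<in> V \<Longrightarrow> g (A j v) = A (Transposition.transpose k i j) (g v)"
      using end_family_symmetry[OF A] by metis
    obtain u where u: "u \<in> V" "v = g u"
      using v aut_on_image_eq[OF g(1) end_familyD(2)[OF A]] by blast
    show ?thesis using g(2)[OF k u(1)] eq u by (simp add: End_C_scale[OF aut_onD(1)[OF g(1)]])
  qed
  then show False using end_familyD(5)[OF A] unfolding nonconstant_on_def by metis
qed

lemma subspace_eigenspace:
  assumes "f \<in> End_C" "vec.subspace V"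
  shows "vec.subspace {v \<in> V. f v = c *s v}"
  using assms
  by (auto simp: vec.subspace_def End_C_add End_C_scale End_C_0 vec.scale_right_distrib mult.commute)

lemma subspace_psubset_dim_less:
  assumes "vec.subspace N" "vec.subspace V" "N \<subset> V"
  shows "vec.dim N < vec.dim V"
  using vec.dim_psubset[of N V] assms vec.span_eq_iff by metis

lemma subspace_dim_pos:
  assumes "v \<in> V" "v \<noteq> 0"
  shows "0 < vec.dim V"
  using assms vec.dim_eq_0[of V] by (metis gr0I singletonD subsetD)

lemma end_family_eigenspace:
  assumes A: "end_family I V A" and k: "k \<in> I"
  obtains c where "vec.subspace {v \<in> V. A k v = c *s v}"
    "0 < vec.dim {v \<in> V. A k v = c *s v}" "vec.dim {v \<in> V. A k v = c *s v} < vec.dim V"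
proof -
  note AD = end_familyD[OF A]
  obtain u where "u \<in> V" "A k u \<noteq> 0 *s u" using end_family_not_scalar[OF A k] by blast
  then have "u \<in> V" "u \<noteq> 0" using End_C_0[OF AD(3)[OF k]] by auto
  then obtain c w where w: "w \<in> V" "w \<noteq> 0" "A k w = c *s w"
    using eigenvector_exists[of "A k" V u] AD(2-4) k by (metis image_subsetI)
  let ?N = "{v \<in> V. A k v = c *s v}"
  have N: "vec.subspace ?N" using subspace_eigenspace AD(2,3) k by blast
  have "?N \<noteq> V" using end_family_not_scalar[OF A k, of c] by blast
  then have "vec.dim ?N < vec.dim V"
    by (intro subspace_psubset_dim_less N AD(2)) auto
  moreover have "0 < vec.dim ?N" using w by (intro subspace_dim_pos[of w]) auto
  ultimately show thesis using that N by blast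
qed

text \<open>On a line every endomorphism is a scalar.\<close>

lemma end_family_dim_ge_2:
  assumes "end_family I V A"
  shows "2 \<le> vec.dim V"
proof -
  obtain k where "k \<in> I" using end_familyD(5)[OF assms] by (auto simp: nonconstant_on_def)
  then obtain c where "vec.subspace {v \<in> V. A k v = c *s v}"
    "0 < vec.dim {v \<in> V. A k v = c *s v}" "vec.dim {v \<in> V. A k v = c *s v} < vec.dim V"
    by (rule end_family_eigenspace[OF assms])
  then show ?thesis by linarith
qed

section \<open>The bounds for endomorphisms and for maps\<close>

text \<open>
  Remove an index \<open>k\<close> and cut along an eigenspace \<open>N\<close> of \<open>A k\<close>.  The two off-diagonal pieces have total
  dimension at most \<open>dim V\<close> and fall under the bound for maps, which allows \<open>dim V\<close> members.  The two
  diagonal pieces live in smaller spaces and also allow at most \<open>dim V\<close> members.  Adding \<open>k\<close> gives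
  the bound.
\<close>

lemma card_end_family_le_step:
  fixes A :: "'i \<Rightarrow> complex^'n \<Rightarrow> complex^'n"
  assumes hom: "\<And>(J :: 'i set) U W (B :: 'i \<Rightarrow> complex^'n \<Rightarrow> complex^'n).
      hom_family J U W B \<Longrightarrow> vec.dim U + vec.dim W \<le> vec.dim V \<Longrightarrow> card J \<le> vec.dim U + vec.dim W"
    and endo: "\<And>(J :: 'i set) U (B :: 'i \<Rightarrow> complex^'n \<Rightarrow> complex^'n).
      end_family J U B \<Longrightarrow> vec.dim U < vec.dim V \<Longrightarrow> card J \<le> vec.dim U + 1"
    and A: "end_family I V A"
  shows "card I \<le> vec.dim V + 1"
proof (cases "3 \<le> card I")
  case False
  then show ?thesis using end_family_dim_ge_2[OF A] by linarith
next
  case True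
  note AD = end_familyD[OF A]
  obtain k where k: "k \<in> I" using AD(5) by (auto simp: nonconstant_on_def)
  define J where "J = I - {k}"
  have J: "finite J" "J \<subseteq> I" "card I = card J + 1"
    using AD(1) k True by (auto simp: J_def)
  obtain c where N: "vec.subspace {v \<in> V. A k v = c *s v}"
    "0 < vec.dim {v \<in> V. A k v = c *s v}" "vec.dim {v \<in> V. A k v = c *s v} < vec.dim V"
    by (rule end_family_eigenspace[OF A k])
  define N where "N = {v \<in> V. A k v = c *s v}"
  note N = N[folded N_def]
  have NV: "N \<subseteq> V" by (auto simp: N_def)
  obtain p where p: "projection_mod N p" using projection_mod_exists[OF N(1)] .
  have sym: "\<exists>g\<in>aut_on V. (\<forall>v\<in>N. g v \<in> N) \<and> (\<forall>i\<in>J. \<forall>v\<in>V. g (A i v) = A (\<sigma> i) (g v))"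
    if "\<sigma> permutes J" for \<sigma>
  proof -
    note \<sigma> = permutes_remove[OF that[unfolded J_def]]
    obtain g where g: "g \<in> aut_on V" "\<And>i v. i \<in> I \<Longrightarrow> v \<in> V \<Longrightarrow> g (A i v) = A (\<sigma> i) (g v)"
      using end_family_symmetry[OF A \<sigma>(1)] by metis
    have "g v \<in> N" if "v \<in> N" for v
      using g(2)[OF k, of v] that \<sigma>(2) aut_onD(2)[OF g(1), of v]
      by (simp add: N_def End_C_scale[OF aut_onD(1)[OF g(1)]])
    then show ?thesis using g J(2) by (intro bexI[of _ g]) auto
  qed
  have nc: "nonconstant_on V J A"
    unfolding J_def using nonconstant_on_remove[OF end_family_imp_hom_family[OF A] True] .
  note dims = dim_projection_image[OF AD(2) N(1) NV p]
  have "hom_family J N (p ` V) (\<lambda>i. p \<circ> centred J A i) \<or> end_family J N (centred J A) \<or>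
    end_family J (p ` V) (\<lambda>i. p \<circ> centred J A i) \<or> hom_family J (p ` V) N (centred J A)"
    using end_family_devissage[OF J(1) AD(2) N(1) NV p _ _ sym nc] AD(3,4) J(2) by blast
  then have "card J \<le> vec.dim V"
  proof (elim disjE)
    assume "hom_family J N (p ` V) (\<lambda>i. p \<circ> centred J A i)"
    from hom[OF this] dims show ?thesis by linarith
  next
    assume "end_family J N (centred J A)"
    from endo[OF this] N(3) show ?thesis by linarith
  next
    assume "end_family J (p ` V) (\<lambda>i. p \<circ> centred J A i)"
    from endo[OF this] N(2) dims show ?thesis by linarith
  next
    assume "hom_family J (p ` V) N (centred J A)"
    from hom[OF this] dims show ?thesis by linarith
  qed
  then show ?thesis using J(3) by simp
qed

lemma subspace_kernel:
  assumes "f \<in> End_C" "vec.subspace V"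
  shows "vec.subspace {v \<in> V. f v = 0}"
  using subspace_eigenspace[OF assms, of 0] by simp

text \<open>
  Remove an index \<open>k\<close> and let \<open>K\<close> be the kernel and \<open>L\<close> the image of \<open>A k\<close>.  If \<open>K\<close> is not 0,
  the remaining members differ as maps \<open>K \<rightarrow> W\<close> or induce a nonconstant family of maps \<open>V/K \<rightarrow> W\<close>.
  If \<open>K\<close> is 0 and \<open>L\<close> is not \<open>W\<close>, they differ as maps \<open>V \<rightarrow> W/L\<close> or induce a nonconstant
  family of maps \<open>V \<rightarrow> L\<close>.  In each case the total dimension drops, which pays for the index \<open>k\<close>.
  If \<open>A k\<close> is an isomorphism, identifying \<open>V\<close> with \<open>W\<close> along it turns a symmetry fixing \<open>k\<close>
  into conjugation by \<open>h\<close>.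
\<close>

lemma card_hom_family_le_step:
  fixes A :: "'i \<Rightarrow> complex^'n \<Rightarrow> complex^'n"
  assumes hom: "\<And>(J :: 'i set) U X (B :: 'i \<Rightarrow> complex^'n \<Rightarrow> complex^'n).
      hom_family J U X B \<Longrightarrow> vec.dim U + vec.dim X < vec.dim V + vec.dim W \<Longrightarrow>
      card J \<le> vec.dim U + vec.dim X"
    and endo: "\<And>(J :: 'i set) U (B :: 'i \<Rightarrow> complex^'n \<Rightarrow> complex^'n).
      end_family J U B \<Longrightarrow> vec.dim U < vec.dim V + vec.dim W \<Longrightarrow> card J \<le> vec.dim U + 1"
    and A: "hom_family I V W A"
  shows "card I \<le> vec.dim V + vec.dim W"
proof -
  note AD = hom_familyD[OF A]
  obtain i j v where ijv: "i \<in> I" "j \<in> I" "v \<in> V" "A i v \<noteq> A j v"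
    using AD(6) by (auto simp: nonconstant_on_def)
  have "v \<noteq> 0" using ijv End_C_0[OF AD(4)] by auto
  then have V0: "0 < vec.dim V" using ijv(3) by (rule subspace_dim_pos[rotated])
  have W0: "0 < vec.dim W"
    using ijv by (intro subspace_dim_pos[of "A i v - A j v"] vec.subspace_diff AD(3,5)) auto
  show ?thesis
  proof (cases "3 \<le> card I")
    case False
    then show ?thesis using V0 W0 by linarith
  next
    case True
    define k where "k = i"
    have k: "k \<in> I" using ijv by (simp add: k_def)
    define J where "J = I - {k}"
    have J: "finite J" "J \<subseteq> I" "card I = card J + 1"
      using AD(1) k True by (auto simp: J_def)
    have nc: "nonconstant_on V J A"
      unfolding J_def using nonconstant_on_remove[OF A True] .
    have sym: "\<exists>g\<in>aut_on V. \<exists>h\<in>aut_on W. (\<forall>v\<in>V. h (A k v) = A k (g v)) \<and>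
        (\<forall>i\<in>J. \<forall>v\<in>V. h (A i v) = A (\<sigma> i) (g v))" if "\<sigma> permutes J" for \<sigma>
    proof -
      note \<sigma> = permutes_remove[OF that[unfolded J_def]]
      show ?thesis using hom_family_symmetry[OF A \<sigma>(1)] k \<sigma>(2) J(2) by (metis subsetD)
    qed
    define B where "B = centred J A"
    have BE: "B i \<in> End_C" if "i \<in> J" for i
      using that AD(4) J(2) by (auto simp: B_def intro!: centred_End_C)
    have BW: "B i v \<in> W" if "i \<in> J" "v \<in> V" for i v
      using that AD(3,5) J(2) by (auto simp: B_def intro!: centred_mem)
    have symB: "\<exists>g\<in>aut_on V. \<exists>h\<in>aut_on W. (\<forall>v\<in>V. h (A k v) = A k (g v)) \<and>
        (\<forall>i\<in>J. \<forall>v\<in>V. h (B i v) = B (\<sigma> i) (g v))" if \<sigma>: "\<sigma> permutes J" for \<sigma>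
    proof -
      obtain g h where gh: "g \<in> aut_on V" "h \<in> aut_on W" "\<forall>v\<in>V. h (A k v) = A k (g v)"
        "\<forall>i\<in>J. \<forall>v\<in>V. h (A i v) = A (\<sigma> i) (g v)" using sym[OF \<sigma>] by blast
      have "h (B i v) = B (\<sigma> i) (g v)" if "i \<in> J" "v \<in> V" for i v
        unfolding B_def
        using centred_equivariant[OF aut_onD(1)[OF gh(2)] \<sigma> that(1), of A v g] gh(4) that(2) by blast
      then show ?thesis using gh by blast
    qed
    have ncB: "nonconstant_on V J B"
      using nc by (simp add: nonconstant_on_def B_def centred_eq_iff)
    define K where "K = {v \<in> V. A k v = 0}"
    define L where "L = A k ` V"
    have K: "vec.subspace K" "K \<subseteq> V"
      using subspace_kernel AD(2,4) k by (auto simp: K_def)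
    have L: "vec.subspace L" "L \<subseteq> W"
      using subspace_image_End_C AD(2,4,5) k by (auto simp: L_def)
    have "K \<noteq> V" using hom_family_not_zero[OF A k] by (auto simp: K_def)
    then have Kdim: "vec.dim K < vec.dim V"
      using K AD(2) by (intro subspace_psubset_dim_less) auto
    have "card J + 1 \<le> vec.dim V + vec.dim W"
    proof (cases "K \<subseteq> {0}")
      case False
      then have K0: "0 < vec.dim K" using subspace_dim_pos[of _ K] by blast
      have gK: "g v \<in> K" if "g \<in> aut_on V" "h \<in> aut_on W" "\<forall>v\<in>V. h (A k v) = A k (g v)" "v \<in> K" for g h v
        using that aut_onD(2)[OF that(1), of v] End_C_0[OF aut_onD(1)[OF that(2)]]
        unfolding K_def by (metis (mono_tags, lifting) mem_Collect_eq)
      show ?thesis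
      proof (cases "nonconstant_on K J A")
        case True
        have "\<exists>g\<in>aut_on K. \<exists>h\<in>aut_on W. \<forall>i\<in>J. \<forall>v\<in>K. h (A i v) = A (\<sigma> i) (g v)"
          if \<sigma>: "\<sigma> permutes J" for \<sigma>
        proof -
          obtain g h where gh: "g \<in> aut_on V" "h \<in> aut_on W" "\<forall>v\<in>V. h (A k v) = A k (g v)"
            "\<forall>i\<in>J. \<forall>v\<in>V. h (A i v) = A (\<sigma> i) (g v)" using sym[OF \<sigma>] by blast
          show ?thesis
            using aut_on_subspace[OF gh(1) K(2) gK[OF gh(1-3)]] gh(2,4) K(2) by blast
        qed
        then have "hom_family J K W A"
          using True J K AD(3,4,5) unfolding hom_family_def by blast
        from hom[OF this] Kdim show ?thesis by linarith
      next
        case constK: False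
        obtain p where p: "projection_mod K p" using projection_mod_exists[OF K(1)] .
        note VK = subspace_projection_image[OF AD(2) K p] and VKV = projection_image_subset[OF AD(2) K p]
        have B0: "B i v = 0" if "i \<in> J" "v \<in> K" for i v
        proof -
          have "A j v = A i v" if "j \<in> J" for j
            using constK that \<open>i \<in> J\<close> \<open>v \<in> K\<close> unfolding nonconstant_on_def by blast
          then show ?thesis unfolding B_def using centred_eq_0_if_const[of J i A v] J(1) that(1) by blast
        qed
        have Bp: "B i (p v) = B i v" if "i \<in> J" for i v
          using B0[OF that projection_modD(4)[OF p], of v] by (simp add: End_C_diff[OF BE[OF that]])
        have "\<exists>g\<in>aut_on (p ` V). \<exists>h\<in>aut_on W. \<forall>i\<in>J. \<forall>v\<in>p ` V. h (B i v) = B (\<sigma> i) (g v)"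
          if \<sigma>: "\<sigma> permutes J" for \<sigma>
        proof -
          obtain g h where gh: "g \<in> aut_on V" "h \<in> aut_on W" "\<forall>v\<in>V. h (A k v) = A k (g v)"
            "\<forall>i\<in>J. \<forall>v\<in>V. h (B i v) = B (\<sigma> i) (g v)" using symB[OF \<sigma>] by blast
          have "h (B i v) = B (\<sigma> i) (p (g v))" if "i \<in> J" "v \<in> p ` V" for i v
            using gh(4) that VKV Bp[of "\<sigma> i"] permutes_in_image[OF \<sigma>] by auto
          then show ?thesis using gh(2) projection_comp_aut_on[OF AD(2) K p gh(1) gK[OF gh(1-3)]]
            by (intro bexI[of _ "p \<circ> g"] bexI[of _ h]) auto
        qed
        moreover have "nonconstant_on (p ` V) J B"
          using ncB Bp unfolding nonconstant_on_def by fastforce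
        ultimately have "hom_family J (p ` V) W B"
          using J VK VKV AD(3) BE BW unfolding hom_family_def by blast
        from hom[OF this] K0 dim_projection_image[OF AD(2) K p] show ?thesis by linarith
      qed
    next
      case K0: True
      have inj: "inj_on (A k) V"
      proof (rule inj_onI)
        fix x y assume xy: "x \<in> V" "y \<in> V" "A k x = A k y"
        then have "x - y \<in> K"
          using vec.subspace_diff[OF AD(2)] by (simp add: K_def End_C_diff[OF AD(4)[OF k]])
        then show "x = y" using K0 by auto
      qed
      have dL: "vec.dim L = vec.dim V"
        unfolding L_def by (rule dim_image_End_C[OF AD(4)[OF k] AD(2) inj])
      have hL: "h v \<in> L" if "g \<in> aut_on V" "h \<in> aut_on W" "\<forall>v\<in>V. h (A k v) = A k (g v)" "v \<in> L" for g h v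
        using that aut_onD(2)[OF that(1)] unfolding L_def by auto
      show ?thesis
      proof (cases "L = W")
        case False
        have Ldim: "vec.dim L < vec.dim W"
          using L AD(3) False by (intro subspace_psubset_dim_less) auto
        obtain p where p: "projection_mod L p" using projection_mod_exists[OF L(1)] .
        note pE = projection_modD(1)[OF p]
        note WL = subspace_projection_image[OF AD(3) L p] and WLW = projection_image_subset[OF AD(3) L p]
        show ?thesis
        proof (cases "nonconstant_on V J (\<lambda>i. p \<circ> A i)")
          case True
          have "\<exists>g\<in>aut_on V. \<exists>h\<in>aut_on (p ` W). \<forall>i\<in>J. \<forall>v\<in>V. h ((p \<circ> A i) v) = (p \<circ> A (\<sigma> i)) (g v)"
            if \<sigma>: "\<sigma> permutes J" for \<sigma>
          proof -
            obtain g h where gh: "g \<in> aut_on V" "h \<in> aut_on W" "\<forall>v\<in>V. h (A k v) = A k (g v)"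
              "\<forall>i\<in>J. \<forall>v\<in>V. h (A i v) = A (\<sigma> i) (g v)" using sym[OF \<sigma>] by blast
            have "p (h (p (A i v))) = p (A (\<sigma> i) (g v))" if "i \<in> J" "v \<in> V" for i v
              using projection_absorb[OF AD(3) L p aut_onD(1)[OF gh(2)] hL[OF gh(1-3)]] gh(4) that by simp
            then show ?thesis using gh(1) projection_comp_aut_on[OF AD(3) L p gh(2) hL[OF gh(1-3)]]
              by (intro bexI[of _ g] bexI[of _ "p \<circ> h"]) auto
          qed
          moreover have "p \<circ> A i \<in> End_C \<and> (p \<circ> A i) ` V \<subseteq> p ` W" if "i \<in> J" for i
            using that J(2) AD(4,5) End_C_comp[OF pE] by auto
          ultimately have "hom_family J V (p ` W) (\<lambda>i. p \<circ> A i)"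
            using True J(1) AD(2) WL unfolding hom_family_def by blast
          from hom[OF this] V0 dL dim_projection_image[OF AD(3) L p] show ?thesis by linarith
        next
          case constW: False
          have BL: "B i v \<in> L" if "i \<in> J" "v \<in> V" for i v
          proof -
            have "p (A j v) = p (A i v)" if "j \<in> J" for j
              using constW that \<open>i \<in> J\<close> \<open>v \<in> V\<close> unfolding nonconstant_on_def comp_def by blast
            then have "p (B i v) = 0" unfolding B_def using centred_eq_0[OF pE J(1) that(1)] by blast
            then show ?thesis by (simp add: projection_modD(2)[OF p])
          qed
          have "\<exists>g\<in>aut_on V. \<exists>h\<in>aut_on L. \<forall>i\<in>J. \<forall>v\<in>V. h (B i v) = B (\<sigma> i) (g v)"
            if \<sigma>: "\<sigma> permutes J" for \<sigma>
          proof -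
            obtain g h where gh: "g \<in> aut_on V" "h \<in> aut_on W" "\<forall>v\<in>V. h (A k v) = A k (g v)"
              "\<forall>i\<in>J. \<forall>v\<in>V. h (B i v) = B (\<sigma> i) (g v)" using symB[OF \<sigma>] by blast
            show ?thesis
              using aut_on_subspace[OF gh(2) L(2) hL[OF gh(1-3)]] gh(1,4) by blast
          qed
          then have "hom_family J V L B"
            using ncB J(1) AD(2) L(1) BE BL unfolding hom_family_def by blast
          from hom[OF this] Ldim show ?thesis by linarith
        qed
      next
        case LW: True
        \<comment> \<open>\<open>q\<close> is the inverse of \<open>A k\<close> on \<open>W\<close>, extended linearly to the whole space\<close>
        have "\<exists>q\<in>End_C. \<forall>v\<in>V. q (A k v) = v"
          using vec.linear_exists_left_inverse_on[of "A k" V] AD(2,4) k inj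
          by (auto simp: End_C_def)
        then obtain q where q: "q \<in> End_C" "\<And>v. v \<in> V \<Longrightarrow> q (A k v) = v" by blast
        have qV: "q w \<in> V" "A k (q w) = w" if "w \<in> W" for w
          using that q(2) LW unfolding L_def by auto
        have "\<exists>h\<in>aut_on W. \<forall>i\<in>J. \<forall>w\<in>W. h ((A i \<circ> q) w) = (A (\<sigma> i) \<circ> q) (h w)"
          if \<sigma>: "\<sigma> permutes J" for \<sigma>
        proof -
          obtain g h where gh: "g \<in> aut_on V" "h \<in> aut_on W" "\<forall>v\<in>V. h (A k v) = A k (g v)"
            "\<forall>i\<in>J. \<forall>v\<in>V. h (A i v) = A (\<sigma> i) (g v)" using sym[OF \<sigma>] by blast
          have "h (A i (q w)) = A (\<sigma> i) (q (h w))" if "i \<in> J" "w \<in> W" for i w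
          proof -
            have "q (h w) = g (q w)"
              using qV[OF that(2)] gh(3) q(2) aut_onD(2)[OF gh(1)] by metis
            then show ?thesis using gh(4) that(1) qV(1)[OF that(2)] by simp
          qed
          then show ?thesis using gh(2) by auto
        qed
        moreover have "A i \<circ> q \<in> End_C \<and> (A i \<circ> q) ` W \<subseteq> W" if "i \<in> J" for i
          using that J(2) AD(5) qV End_C_comp[OF AD(4) q(1)] by auto
        moreover have "nonconstant_on W J (\<lambda>i. A i \<circ> q)"
        proof -
          obtain i j v where "i \<in> J" "j \<in> J" "v \<in> V" "A i v \<noteq> A j v"
            using nc by (auto simp: nonconstant_on_def)
          then show ?thesis
            using q(2) AD(5)[OF k] unfolding nonconstant_on_def comp_def
            by (intro bexI[of _ i] bexI[of _ j] bexI[of _ "A k v"]) auto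
        qed
        ultimately have E: "end_family J W (\<lambda>i. A i \<circ> q)"
          using J(1) AD(3) unfolding end_family_def by blast
        \<comment> \<open>with \<open>d = dim V = dim W\<close> the bound is \<open>d + 2 \<le> 2 * d\<close>, which uses \<open>d \<ge> 2\<close>\<close>
        from endo[OF E] end_family_dim_ge_2[OF E] V0 dL LW show ?thesis by simp
      qed
    qed
    then show ?thesis using J(3) by simp
  qed
qed

text \<open>
  At total dimension \<open>n\<close>, the bound for maps uses the bound for endomorphisms only in dimensions below
  \<open>n\<close>, while the bound for endomorphisms of an \<open>n\<close>-dimensional space uses the one for maps at total
  dimension \<open>n\<close>.  So the two are proved in this order inside one induction.
\<close>

lemma card_hom_and_end_family_le:
  "(\<forall>(I :: 'i set) V W (A :: 'i \<Rightarrow> complex^'n \<Rightarrow> complex^'n).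
      hom_family I V W A \<longrightarrow> vec.dim V + vec.dim W = n \<longrightarrow> card I \<le> vec.dim V + vec.dim W) \<and>
   (\<forall>(I :: 'i set) V (A :: 'i \<Rightarrow> complex^'n \<Rightarrow> complex^'n).
      end_family I V A \<longrightarrow> vec.dim V = n \<longrightarrow> card I \<le> vec.dim V + 1)"
proof (induction n rule: less_induct)
  case (less n)
  have hom: "card I \<le> vec.dim V + vec.dim W"
    if "hom_family I V W A" "vec.dim V + vec.dim W = n"
    for I :: "'i set" and V W and A :: "'i \<Rightarrow> complex^'n \<Rightarrow> complex^'n"
    by (rule card_hom_family_le_step[OF _ _ that(1)]) (use less that(2) in blast)+
  have "card I \<le> vec.dim V + 1"
    if "end_family I V A" "vec.dim V = n"
    for I :: "'i set" and V and A :: "'i \<Rightarrow> complex^'n \<Rightarrow> complex^'n"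
    by (rule card_end_family_le_step[OF _ _ that(1)]) (use less that(2) hom in \<open>metis le_neq_implies_less\<close>)+
  then show ?case using hom by blast
qed

theorem card_hom_family_le:
  fixes A :: "'i \<Rightarrow> complex^'n \<Rightarrow> complex^'n"
  shows "hom_family I V W A \<Longrightarrow> card I \<le> vec.dim V + vec.dim W"
  using card_hom_and_end_family_le by blast

theorem card_end_family_le:
  fixes A :: "'i \<Rightarrow> complex^'n \<Rightarrow> complex^'n"
  shows "end_family I V A \<Longrightarrow> card I \<le> vec.dim V + 1"
  using card_hom_and_end_family_le by blast

section \<open>The bound for commuting endomorphisms\<close>

text \<open>
  Applying \<open>A j - m\<close> to a linear relation among the \<open>v i\<close> removes every term except the one of \<open>v j\<close>.
\<close>

lemma card_le_dim_if_diagonal_eigenvectors: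
  assumes I: "finite I" and V: "\<And>i. i \<in> I \<Longrightarrow> v i \<in> V"
    and A: "\<And>i. i \<in> I \<Longrightarrow> A i \<in> End_C" and v0: "\<And>i. i \<in> I \<Longrightarrow> v i \<noteq> 0"
    and diag: "\<And>i. i \<in> I \<Longrightarrow> A i (v i) = c *s v i"
    and off: "\<And>i j. i \<in> I \<Longrightarrow> j \<in> I \<Longrightarrow> i \<noteq> j \<Longrightarrow> A j (v i) = m *s v i"
    and "c \<noteq> m"
  shows "card I \<le> vec.dim V"
proof -
  have inj: "inj_on v I"
  proof (rule inj_onI, rule ccontr)
    fix i j assume ij: "i \<in> I" "j \<in> I" "v i = v j" "i \<noteq> j"
    then have "c *s v j = m *s v j" using diag[OF ij(1)] off[OF ij(2,1)] by metis
    then show False using v0 ij \<open>c \<noteq> m\<close> by simp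
  qed
  have "vec.independent (v ` I)"
  proof (rule vec.independent_if_scalars_zero)
    fix f x assume s: "(\<Sum>x\<in>v ` I. f x *s x) = 0" and "x \<in> v ` I"
    then obtain j where j: "j \<in> I" "x = v j" by auto
    have s: "(\<Sum>i\<in>I. f (v i) *s v i) = 0" using s by (simp add: sum.reindex[OF inj])
    have "0 = A j (\<Sum>i\<in>I. f (v i) *s v i) - m *s (\<Sum>i\<in>I. f (v i) *s v i)"
      by (simp add: s End_C_0[OF A[OF j(1)]])
    also have "\<dots> = (\<Sum>i\<in>I. f (v i) *s (A j (v i) - m *s v i))"
      by (simp add: End_C_sum[OF A[OF j(1)]] End_C_scale[OF A[OF j(1)]] vec.scale_sum_right
          sum_subtractf vec.scale_right_diff_distrib mult.commute)
    also have "\<dots> = (\<Sum>i\<in>I. if i = j then (f x * (c - m)) *s v j else 0)"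
      using j by (intro sum.cong) (auto simp: diag off vec.scale_left_diff_distrib
          vec.scale_right_diff_distrib algebra_simps)
    also have "\<dots> = (f x * (c - m)) *s v j" using I j by simp
    finally show "f x = 0" using v0[OF j(1)] \<open>c \<noteq> m\<close> by simp
  qed (use I in simp)
  then have "card (v ` I) \<le> vec.dim V"
    using V by (intro vec.independent_card_le_dim) auto
  then show ?thesis by (simp add: card_image[OF inj])
qed

text \<open>
  Cutting along the eigenspace \<open>N\<close> of \<open>A k\<close> loses the index \<open>k\<close>, and the piece \<open>V/N \<rightarrow> N\<close> would then
  give no more than \<open>card I \<le> dim V + 1\<close>.  This piece matters only if the other members agree on \<open>N\<close>;
  then either their common eigenvalue separates them from \<open>A k\<close>, or the cut can be made along the joint
  eigenspace \<open>N0\<close>, which the whole symmetric group preserves.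
\<close>

theorem card_commuting_end_family_le:
  fixes A :: "'i \<Rightarrow> complex^'n \<Rightarrow> complex^'n"
  assumes "end_family I V A"
    and "\<And>i j v. i \<in> I \<Longrightarrow> j \<in> I \<Longrightarrow> v \<in> V \<Longrightarrow> A i (A j v) = A j (A i v)"
  shows "card I \<le> vec.dim V"
  using assms
proof (induction "vec.dim V" arbitrary: I V A rule: less_induct)
  case less
  note A = less.prems(1) and comm = less.prems(2)
  note AD = end_familyD[OF A]
  show ?case
  proof (cases "3 \<le> card I")
    case False
    then show ?thesis using end_family_dim_ge_2[OF A] by linarith
  next
    case True
    obtain k where k: "k \<in> I" using AD(5) by (auto simp: nonconstant_on_def)
    define J where "J = I - {k}"
    have J: "finite J" "J \<subseteq> I" "card I = card J + 1"
      using AD(1) k True by (auto simp: J_def)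
    obtain c where N: "vec.subspace {v \<in> V. A k v = c *s v}"
      "0 < vec.dim {v \<in> V. A k v = c *s v}" "vec.dim {v \<in> V. A k v = c *s v} < vec.dim V"
      by (rule end_family_eigenspace[OF A k])
    define N where "N = {v \<in> V. A k v = c *s v}"
    note N = N[folded N_def]
    have NV: "v \<in> V" if "v \<in> N" for v using that by (simp add: N_def)
    have AN: "A i v \<in> N" if "i \<in> I" "v \<in> N" for i v
      using that k AD(4) comm[of k i v] by (simp add: N_def End_C_scale[OF AD(3)])
    show ?thesis
    proof (cases "nonconstant_on N J A")
      case True
      have "\<exists>g\<in>aut_on N. \<forall>i\<in>J. \<forall>v\<in>N. g (A i v) = A (\<sigma> i) (g v)" if "\<sigma> permutes J" for \<sigma>
      proof -
        note \<sigma> = permutes_remove[OF that[unfolded J_def]]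
        obtain g where g: "g \<in> aut_on V" "\<And>i v. i \<in> I \<Longrightarrow> v \<in> V \<Longrightarrow> g (A i v) = A (\<sigma> i) (g v)"
          using end_family_symmetry[OF A \<sigma>(1)] by metis
        have "g v \<in> N" if "v \<in> N" for v
          using g(2)[OF k, of v] that \<sigma>(2) aut_onD(2)[OF g(1), of v]
          by (simp add: N_def End_C_scale[OF aut_onD(1)[OF g(1)]])
        then have "g \<in> aut_on N" using aut_on_subspace[OF g(1)] NV by blast
        then show ?thesis using g(2) J(2) NV by blast
      qed
      then have "end_family J N A"
        using True J(1) N(1) AD(3) AN J(2) unfolding end_family_def by blast
      moreover have "A i (A j v) = A j (A i v)" if "i \<in> J" "j \<in> J" "v \<in> N" for i j v
        using that J(2) NV comm by blast
      ultimately have "card J \<le> vec.dim N" using less.hyps[OF N(3)] by blast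
      then show ?thesis using J(3) N(3) by linarith
    next
      case constN: False
      obtain j where j: "j \<in> J" using J True by (cases "J = {}") auto
      obtain u where u: "u \<in> N" "u \<noteq> 0"
        using N(2) vec.dim_eq_0[of N] by fastforce
      obtain m w where w: "w \<in> N" "w \<noteq> 0" "A j w = m *s w"
        using eigenvector_exists[of "A j" N u] AD(3) AN N(1) u j J(2) by (metis image_subsetI subsetD)
      have wJ: "A i w = m *s w" if "i \<in> J" for i
        using constN that j w(1,3) unfolding nonconstant_on_def by metis
      have wk: "A k w = c *s w" using w(1) by (simp add: N_def)
      show ?thesis
      proof (cases "c = m")
        case False
        \<comment> \<open>the symmetry that exchanges \<open>k\<close> and \<open>i\<close> moves the special eigenvalue \<open>c\<close> from \<open>A k\<close> to \<open>A i\<close>\<close>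
        have "\<exists>x\<in>V. x \<noteq> 0 \<and> A i x = c *s x \<and> (\<forall>l\<in>I. l \<noteq> i \<longrightarrow> A l x = m *s x)" if i: "i \<in> I" for i
        proof -
          let ?\<tau> = "Transposition.transpose k i"
          have \<tau>: "?\<tau> permutes I" using i k by (intro permutes_swap_id)
          obtain g where g: "g \<in> aut_on V" "\<And>l v. l \<in> I \<Longrightarrow> v \<in> V \<Longrightarrow> g (A l v) = A (?\<tau> l) (g v)"
            using end_family_symmetry[OF A \<tau>] by metis
          note gE = aut_onD(1)[OF g(1)]
          have wV: "w \<in> V" using w(1) NV by blast
          have "g w \<noteq> 0"
            using aut_onD(3)[OF g(1) wV vec.subspace_0[OF AD(2)]] w(2) End_C_0[OF gE] by auto
          moreover have "A i (g w) = c *s g w"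
            using g(2)[OF k wV] wk by (simp add: End_C_scale[OF gE])
          moreover have "A l (g w) = m *s g w" if l: "l \<in> I" "l \<noteq> i" for l
          proof -
            have "?\<tau> l \<in> I" "?\<tau> l \<noteq> k"
              using l permutes_in_image[OF \<tau>] by (auto simp: Transposition.transpose_def)
            then have "?\<tau> l \<in> J" by (simp add: J_def)
            then show ?thesis
              using g(2)[OF \<open>?\<tau> l \<in> I\<close> wV] wJ[of "?\<tau> l"] by (simp add: End_C_scale[OF gE])
          qed
          ultimately show ?thesis using aut_onD(2)[OF g(1) wV] by blast
        qed
        then obtain x where x: "\<And>i. i \<in> I \<Longrightarrow> x i \<in> V \<and> x i \<noteq> 0 \<and> A i (x i) = c *s x i \<and>
            (\<forall>l\<in>I. l \<noteq> i \<longrightarrow> A l (x i) = m *s x i)" by metis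
        show ?thesis
          by (rule card_le_dim_if_diagonal_eigenvectors[OF AD(1) _ AD(3) _ _ _ False, of x])
            (use x in auto)
      next
        case True
        \<comment> \<open>all members act on \<open>N0\<close> as the same scalar, which rules out the pieces starting in \<open>N0\<close>\<close>
        define N0 where "N0 = {v \<in> V. \<forall>i\<in>I. A i v = c *s v}"
        have N0: "vec.subspace N0" "N0 \<subseteq> V"
          using AD(2,3) by (auto simp: N0_def vec.subspace_def End_C_add End_C_scale End_C_0
              vec.scale_right_distrib mult.commute)
        have "w \<in> N0" using w(1) NV wJ wk True by (auto simp: N0_def J_def)
        then have N0dim: "0 < vec.dim N0" using w(2) by (rule subspace_dim_pos)
        obtain p where p: "projection_mod N0 p" using projection_mod_exists[OF N0(1)] .
        note dims = dim_projection_image[OF AD(2) N0 p]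
        have sym: "\<exists>g\<in>aut_on V. (\<forall>v\<in>N0. g v \<in> N0) \<and> (\<forall>i\<in>I. \<forall>v\<in>V. g (A i v) = A (\<sigma> i) (g v))"
          if \<sigma>: "\<sigma> permutes I" for \<sigma>
        proof -
          obtain g where g: "g \<in> aut_on V" "\<And>i v. i \<in> I \<Longrightarrow> v \<in> V \<Longrightarrow> g (A i v) = A (\<sigma> i) (g v)"
            using end_family_symmetry[OF A \<sigma>] by metis
          have "A i (g v) = c *s g v" if "i \<in> I" "v \<in> N0" for i v
          proof -
            obtain l where "l \<in> I" "i = \<sigma> l" using permutes_image[OF \<sigma>] \<open>i \<in> I\<close> by blast
            then show ?thesis using g(2)[of l v] that(2)
              by (auto simp: N0_def End_C_scale[OF aut_onD(1)[OF g(1)]])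
          qed
          then have "\<forall>v\<in>N0. g v \<in> N0" using aut_onD(2)[OF g(1)] N0(2) by (auto simp: N0_def)
          then show ?thesis using g by blast
        qed
        define B where "B = centred I A"
        have B_eq: "B i v = B j v" if "i \<in> I" "j \<in> I" "v \<in> N0" for i j v
          using that by (simp add: B_def centred_eq_iff N0_def)
        have "hom_family I N0 (p ` V) (\<lambda>i. p \<circ> B i) \<or> end_family I N0 B \<or>
            end_family I (p ` V) (\<lambda>i. p \<circ> B i) \<or> hom_family I (p ` V) N0 B"
          unfolding B_def using end_family_devissage[OF AD(1,2) N0 p AD(3,4) sym AD(5)] by blast
        then show ?thesis
        proof (elim disjE)
          assume "hom_family I N0 (p ` V) (\<lambda>i. p \<circ> B i)"
          from hom_familyD(6)[OF this] B_eq have False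
            unfolding nonconstant_on_def comp_def by metis
          then show ?thesis ..
        next
          assume "end_family I N0 B"
          from end_familyD(5)[OF this] B_eq have False
            unfolding nonconstant_on_def by metis
          then show ?thesis ..
        next
          assume E: "end_family I (p ` V) (\<lambda>i. p \<circ> B i)"
          have BE: "B i \<in> End_C" if "i \<in> I" for i
            unfolding B_def using that AD(3) by (intro centred_End_C)
          have BN: "B i v \<in> N0" if "i \<in> I" "v \<in> N0" for i v
          proof -
            have "A j v \<in> N0" if "j \<in> I" for j
              using vec.subspace_scale[OF N0(1) \<open>v \<in> N0\<close>, of c] \<open>v \<in> N0\<close> that by (simp add: N0_def)
            then show ?thesis unfolding B_def using N0(1) that(1) by (intro centred_mem)
          qed
          have "(p \<circ> B i) ((p \<circ> B l) x) = (p \<circ> B l) ((p \<circ> B i) x)"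
            if il: "i \<in> I" "l \<in> I" and x: "x \<in> p ` V" for i l x
          proof -
            have xV: "x \<in> V" using x projection_image_subset[OF AD(2) N0 p] by blast
            have "B i (B l x) = B l (B i x)"
              unfolding B_def by (rule centred_commute[where A = A]) (use AD(3) il comm xV in blast)+
            then show ?thesis
              using projection_absorb[OF AD(2) N0 p BE[OF il(1)] BN[OF il(1)]]
                projection_absorb[OF AD(2) N0 p BE[OF il(2)] BN[OF il(2)]] by simp
          qed
          moreover have "vec.dim (p ` V) < vec.dim V" using N0dim dims by linarith
          ultimately have "card I \<le> vec.dim (p ` V)" using less.hyps[OF _ E] by blast
          then show ?thesis using dims by linarith
        next
          assume "hom_family I (p ` V) N0 B"
          from card_hom_family_le[OF this] dims show ?thesis by linarith
        qed
      qed
    qed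
  qed
qed

section \<open>Totally symmetric sets\<close>

text \<open>
  For \<open>k \<ge> 2\<close> an enumeration of the set is a nonconstant symmetric family on the whole space; for
  \<open>k \<le> 1\<close> the bounds hold because the dimension is at least 1.
\<close>

theorem theorem1:
  fixes \<A> :: "(complex^'n \<Rightarrow> complex^'n) set" and k :: nat
  assumes "totally_symmetric_set k \<A>"
  shows "k \<le> CARD('n) + 1 \<and> (commutative_set \<A> \<longrightarrow> k \<le> CARD('n))"
proof (cases "2 \<le> k")
  case False
  have "1 \<le> CARD('n)" by (simp add: Suc_leI)
  then show ?thesis using False by linarith
next
  case True
  obtain A where bij: "bij_betw A {1..k} \<A>" and AE: "\<A> \<subseteq> End_C"
    and sym: "\<And>\<sigma>. \<sigma> permutes {1..k} \<Longrightarrow>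
      \<exists>\<rho>\<in>GL_C. \<forall>i\<in>{1..k}. \<rho> \<circ> A i \<circ> inv \<rho> = A (\<sigma> i)"
    using assms by (auto simp: totally_symmetric_set_def)
  have Ai: "A i \<in> \<A>" if "i \<in> {1..k}" for i using bij_betwE[OF bij] that by blast
  have "\<exists>g\<in>aut_on UNIV. \<forall>i\<in>{1..k}. \<forall>v\<in>UNIV. g (A i v) = A (\<sigma> i) (g v)"
    if \<sigma>: "\<sigma> permutes {1..k}" for \<sigma>
  proof -
    obtain \<rho> where \<rho>: "\<rho> \<in> GL_C" "\<And>i. i \<in> {1..k} \<Longrightarrow> \<rho> \<circ> A i \<circ> inv \<rho> = A (\<sigma> i)"
      using sym[OF \<sigma>] by blast
    then have inj: "inj \<rho>" and E: "\<rho> \<in> End_C" by (auto simp: GL_C_def bij_is_inj)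
    have "\<rho> (A i v) = A (\<sigma> i) (\<rho> v)" if "i \<in> {1..k}" for i v
      using fun_cong[OF \<rho>(2)[OF that], of "\<rho> v"] inj by simp
    then show ?thesis using inj E by (auto simp: aut_on_def)
  qed
  moreover have "nonconstant_on UNIV {1..k} A"
  proof -
    have "A 1 \<noteq> A 2"
      using bij_betw_imp_inj_on[OF bij] True by (auto dest: inj_onD[of A _ 1 2])
    then obtain v where "A 1 v \<noteq> A 2 v" by auto
    then show ?thesis using True unfolding nonconstant_on_def by force
  qed
  ultimately have F: "end_family {1..k} UNIV A"
    using Ai AE unfolding end_family_def by auto
  have dim: "vec.dim (UNIV :: (complex^'n) set) = CARD('n)"
    by (simp add: card_cart_basis)
  have "k \<le> CARD('n)" if c: "commutative_set \<A>"
  proof -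
    have "A i (A j v) = A j (A i v)" if "i \<in> {1..k}" "j \<in> {1..k}" for i j v
      using c Ai that unfolding commutative_set_def by (metis comp_apply)
    then show ?thesis using card_commuting_end_family_le[OF F] dim by simp
  qed
  then show ?thesis using card_end_family_le[OF F] dim by simp
qed

end
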